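(* Let $\vec\alpha_T:=(\alpha_1,\dots,\alpha_T)\in\mathbb C^T$. If $N\ge16(2T+1)T^{5/2}$ and the $\ell_1$-norm of $\vec\alpha_T$ is sufficiently small, $\|\vec\alpha_T\|_1\le\frac14$, then there exists a unitary matrix $U\in\mathrm U(N)$ such that $$\alpha_k=\frac1N\mathrm{tr}(U^k)\qquad\text{for each }k\in\{1,\dots,T\}.$$
   Context: $T,N\ge1$ are integers; $\mathrm U(N)$ is the group of $N\times N$ unitary matrices and $\|\vec\alpha_T\|_1=\sum_{k=1}^T|\alpha_k|$. *)

theory Defs
  imports Complex_Main "Jordan_Normal_Form.Schur_Decomposition"
begin

definition mat_trace :: "'a :: comm_monoid_add mat \<Rightarrow> 'a" where
  "mat_trace A = (\<Sum>i<dim_row A. A $$ (i, i))"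

definition unitary_group :: "nat \<Rightarrow> complex mat set" where
  "unitary_group N =
     {U \<in> carrier_mat N N. U * mat_adjoint U = 1\<^sub>m N \<and> mat_adjoint U * U = 1\<^sub>m N}"

end

theory Submission
  imports Defs
begin

text \<open>
  The eigenvalues are the inverses of the roots of a polynomial \<open>p\<close> of degree \<open>N\<close> with
  \<open>p' \<equiv> p s\<close> modulo \<open>z^T\<close>, where \<open>s = - (\<Sum>k = 1..T. N \<alpha>\<^sub>k z^(k-1))\<close>; this congruence is Newton's
  identities for the first \<open>T\<close> power sums. It suffices to find a solution \<open>q\<close> with \<open>q(0) = 1\<close>, of
  degree below \<open>N - T\<close> and without zeros in the closed unit disc: the self-inversive
  \<open>p(z) = q(z) + z^N cnj (q(1 / cnj z))\<close> agrees with \<open>q\<close> up to order \<open>T\<close>, and all its roots lie on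
  the unit circle. The power series solution is \<open>exp (- (\<Sum>k = 1..T. N \<alpha>\<^sub>k z^k / k))\<close>. Truncating it
  as a whole may create zeros in the disc, so \<open>q\<close> is taken as a product over \<open>k\<close> of powers
  \<open>h(c z^k)^m\<close>, with \<open>h\<close> the exponential series truncated at degree \<open>L = T div k\<close> and \<open>m\<close> so large
  that \<open>\<bar>c\<bar> \<le> 4 L / 15\<close>, which keeps the zeros of each factor outside the disc. The total degree is
  then at most \<open>15/4 N (\<Sum>k = 1..T. \<bar>\<alpha>\<^sub>k\<bar>) + T\<^sup>2 \<le> 15/16 N + T\<^sup>2\<close>.
\<close>

section \<open>Diagonal unitary matrices\<close>

lemma mat_adjoint_mat_diag:
  fixes f :: "nat \<Rightarrow> complex"
  shows "mat_adjoint (mat_diag n f) = mat_diag n (\<lambda>i. cnj (f i))"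
  by (rule eq_matI) (auto simp: mat_adjoint_def mat_diag_def mat_of_rows_index)

lemma mat_diag_pow: "mat_diag n f ^\<^sub>m k = mat_diag n (\<lambda>i. f i ^ k)"
  for f :: "nat \<Rightarrow> 'a :: comm_ring_1"
proof (induction k)
  case 0
  show ?case
    by (simp add: mat_diag_def)
qed (simp add: mult.commute)

lemma mat_diag_unitary:
  assumes "\<And>i. i < n \<Longrightarrow> cmod (f i) = 1"
  shows "mat_diag n f \<in> unitary_group n"
proof -
  have "mat_diag n (\<lambda>i. f i * cnj (f i)) = 1\<^sub>m n"
    by (rule eq_matI) (auto simp: mat_diag_def assms simp flip: complex_norm_square)
  then show ?thesis
    by (simp add: unitary_group_def mat_adjoint_mat_diag mult.commute)
qed

lemma mat_trace_diag: "mat_trace (mat_diag n f) = (\<Sum>i<n. f i)"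
  by (simp add: mat_trace_def mat_diag_def)

section \<open>Logarithmic derivatives modulo a power of the variable\<close>

text \<open>Division-free form of \<open>p' / p = s\<close> modulo \<open>z^n\<close>. For fixed
  \<open>s\<close> the condition is linear in \<open>p\<close>, so a summand of high order can be
  added.\<close>

definition log_deriv_cong :: "nat \<Rightarrow> 'a :: idom poly \<Rightarrow> 'a poly \<Rightarrow> bool" where
  "log_deriv_cong n p s \<longleftrightarrow> monom 1 n dvd pderiv p - p * s"

lemma log_deriv_cong_1: "log_deriv_cong n 1 0"
  by (simp add: log_deriv_cong_def)

lemma log_deriv_cong_add:
  assumes "log_deriv_cong n p s" and "log_deriv_cong n q s"
  shows "log_deriv_cong n (p + q) s"
proof -
  have "pderiv (p + q) - (p + q) * s = (pderiv p - p * s) + (pderiv q - q * s)"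
    by (simp add: pderiv_add algebra_simps)
  then show ?thesis
    using assms by (simp add: log_deriv_cong_def)
qed

lemma log_deriv_cong_mult:
  assumes "log_deriv_cong n p s" and "log_deriv_cong n q t"
  shows "log_deriv_cong n (p * q) (s + t)"
proof -
  have "pderiv (p * q) - (p * q) * (s + t) = q * (pderiv p - p * s) + p * (pderiv q - q * t)"
    by (simp add: pderiv_mult algebra_simps)
  then show ?thesis
    using assms by (simp add: log_deriv_cong_def)
qed

lemma log_deriv_cong_power:
  assumes "log_deriv_cong n p s"
  shows "log_deriv_cong n (p ^ m) (of_nat m * s)"
proof (induction m)
  case (Suc m)
  then show ?case
    using log_deriv_cong_mult[OF assms] by (simp add: distrib_right)
qed (simp add: log_deriv_cong_1)

lemma log_deriv_cong_prod:
  assumes "\<And>i. i \<in> A \<Longrightarrow> log_deriv_cong n (p i) (s i)"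
  shows "log_deriv_cong n (prod p A) (sum s A)"
  using assms
  by (induction A rule: infinite_finite_induct)
     (auto simp: log_deriv_cong_1 intro: log_deriv_cong_mult)

text \<open>A nonzero constant coefficient makes \<open>p\<close> cancellable modulo
  \<open>z^n\<close>: once the lower coefficients of \<open>s - t\<close> vanish, coefficient
  \<open>k\<close> of \<open>p * (s - t)\<close> is
  \<open>coeff p 0 * coeff (s - t) k\<close>.\<close>

lemma log_deriv_cong_unique:
  assumes "log_deriv_cong n p s" and "log_deriv_cong n p t" and "coeff p 0 \<noteq> 0" and "k < n"
  shows "coeff s k = coeff t k"
proof -
  have "monom 1 n dvd p * (s - t)"
    using dvd_diff[OF assms(2)[unfolded log_deriv_cong_def] assms(1)[unfolded log_deriv_cong_def]]
    by (simp add: algebra_simps)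
  then have zero: "coeff (p * (s - t)) k = 0" if "k < n" for k
    using that by (simp add: monom_1_dvd_iff')
  have "coeff (s - t) k = 0"
    using \<open>k < n\<close>
  proof (induction k rule: less_induct)
    case (less k)
    have "coeff (p * (s - t)) k = (\<Sum>i\<in>{0}. coeff p i * coeff (s - t) (k - i))"
      unfolding coeff_mult by (rule sum.mono_neutral_right) (use less in auto)
    then show ?case
      using zero[OF less.prems] assms(3) by simp
  qed
  then show ?thesis
    by simp
qed

text \<open>The geometric series of \<open>1 / (z - a)\<close> at 0, cut off before
  \<open>z^n\<close>; the product telescopes and leaves exactly \<open>z^n / a^n\<close>.\<close>

lemma log_deriv_cong_linear:
  fixes a :: "'a :: field"
  assumes "a \<noteq> 0"
  shows "log_deriv_cong n [:- a, 1:] (- (\<Sum>i<n. monom (inverse a ^ Suc i) i))"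
proof -
  have "[:- a, 1:] * (\<Sum>i<n. monom (inverse a ^ Suc i) i) = monom (inverse a ^ n) n - 1"
  proof (induction n)
    case (Suc n)
    have "[:- a, 1:] * monom (inverse a ^ Suc n) n
        = monom (inverse a ^ Suc n) (Suc n) - monom (inverse a ^ n) n"
      using assms by (simp add: monom_Suc smult_monom flip: minus_monom mult.assoc)
    then show ?case
      using Suc by (simp add: distrib_left)
  qed simp
  then have "pderiv [:- a, 1:] - [:- a, 1:] * - (\<Sum>i<n. monom (inverse a ^ Suc i) i)
      = monom (inverse a ^ n) n"
    by (simp add: pderiv_pCons del: mult_pCons_left)
  then show ?thesis
    by (simp add: log_deriv_cong_def monom_1_dvd_iff')
qed

text \<open>Adding the logarithmic derivatives of the factors produces the power sums of the inverse
  roots, which is where Newton's identities enter.\<close>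

lemma log_deriv_cong_linear_factors:
  fixes as :: "'a :: field list"
  assumes "0 \<notin> set as"
  shows "log_deriv_cong n (\<Prod>a\<leftarrow>as. [:- a, 1:])
           (- (\<Sum>i<n. monom (\<Sum>a\<leftarrow>as. inverse a ^ Suc i) i))"
  using assms
proof (induction as)
  case Nil
  then show ?case
    by (simp add: log_deriv_cong_1)
next
  case (Cons a as)
  have "log_deriv_cong n ([:- a, 1:] * (\<Prod>a\<leftarrow>as. [:- a, 1:]))
     (- (\<Sum>i<n. monom (inverse a ^ Suc i) i)
      + - (\<Sum>i<n. monom (\<Sum>a\<leftarrow>as. inverse a ^ Suc i) i))"
    using Cons by (intro log_deriv_cong_mult log_deriv_cong_linear) auto
  also have "(- (\<Sum>i<n. monom (inverse a ^ Suc i) i)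
      + - (\<Sum>i<n. monom (\<Sum>a\<leftarrow>as. inverse a ^ Suc i) i))
     = - (\<Sum>i<n. monom (\<Sum>a\<leftarrow>a # as. inverse a ^ Suc i) i)"
    by (simp add: sum.distrib flip: add_monom)
  finally show ?case
    by simp
qed

section \<open>Truncated exponentials\<close>

text \<open>After division by \<open>fact n\<close>, the left side is a single term of the series of
  \<open>exp n\<close>.\<close>

lemma power_le_fact_mult_exp: "real n ^ n \<le> fact n * exp (real n)"
proof -
  have "real n ^ n /\<^sub>R fact n \<le> (\<Sum>k. real n ^ k /\<^sub>R fact k)"
    using summable_exp_generic[of "real n"]
    by (intro order_trans[OF _ sum_le_suminf[of _ "{n}"]]) auto
  then show ?thesis
    by (simp add: exp_def field_simps)
qed

text \<open>Since \<open>L^L <= L! e^L\<close> and \<open>(L+1+j)! >= L! (L+1)^(j+1)\<close>, the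
  term of index \<open>L+1+j\<close> is at most \<open>c^(j+1) (c e)^L\<close>, so a geometric
  series dominates the tail.\<close>

lemma exp_tail_le:
  fixes y :: complex and c :: real
  assumes "cmod y \<le> c * real L" and "0 \<le> c" and "c < 1"
  shows "cmod (exp y - (\<Sum>j\<le>L. y ^ j / fact j)) \<le> c / (1 - c) * (c * exp 1) ^ L"
proof -
  have pt: "cmod (y ^ (j + Suc L) / fact (j + Suc L)) \<le> c ^ j * (c * (c * exp 1) ^ L)" for j
  proof -
    have "cmod (y ^ (j + Suc L)) \<le> (c * real L) ^ (j + Suc L)"
      unfolding norm_power by (intro power_mono assms) auto
    also have "\<dots> = c ^ (j + Suc L) * (real L ^ L * real L ^ Suc j)"
      by (simp add: power_mult_distrib power_add)
    also have "\<dots> \<le> c ^ (j + Suc L) * ((fact L * exp (real L)) * real (Suc L) ^ Suc j)"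
      using assms
      by (intro mult_left_mono mult_mono power_le_fact_mult_exp power_mono) auto
    also have "fact L * exp (real L) * real (Suc L) ^ Suc j
        = (fact L * real (Suc L) ^ Suc j) * exp (real L)"
      by simp
    also have "c ^ (j + Suc L) * \<dots> \<le> c ^ (j + Suc L) * (fact (j + Suc L) * exp (real L))"
    proof (intro mult_left_mono mult_right_mono)
      show "fact L * real (Suc L) ^ Suc j \<le> fact (j + Suc L)"
      proof (induction j)
        case (Suc j)
        have "fact L * real (Suc L) ^ Suc (Suc j) = real (Suc L) * (fact L * real (Suc L) ^ Suc j)"
          by simp
        also have "\<dots> \<le> real (Suc (j + Suc L)) * fact (j + Suc L)"
          by (intro mult_mono Suc) auto
        also have "\<dots> = fact (Suc j + Suc L)"
          by (simp only: add_Suc fact_Suc of_nat_mult)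
        finally show ?case .
      qed simp
    qed (use assms in auto)
    finally have "cmod (y ^ (j + Suc L)) \<le> c ^ j * (c * (c * exp 1) ^ L) * fact (j + Suc L)"
      by (simp add: power_mult_distrib power_add exp_of_nat_mult[symmetric] mult_ac
               del: fact_Suc add_Suc_right)
    then show ?thesis
      by (simp add: norm_divide divide_le_eq del: fact_Suc add_Suc_right power_Suc)
  qed
  have "(\<lambda>j. y ^ j / fact j) sums exp y"
    using exp_converges[of y] by (simp add: scaleR_conv_of_real field_simps)
  then have tail: "(\<lambda>j. y ^ (j + Suc L) / fact (j + Suc L)) sums (exp y - (\<Sum>j\<le>L. y ^ j / fact j))"
    unfolding lessThan_Suc_atMost[symmetric] by (rule sums_split_initial_segment)
  have geo: "(\<lambda>j. c ^ j * (c * (c * exp 1) ^ L)) sums (1 / (1 - c) * (c * (c * exp 1) ^ L))"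
    using assms by (intro sums_mult2 geometric_sums) auto
  show ?thesis
    using norm_suminf_le[OF pt sums_summable[OF geo]] sums_unique[OF tail] sums_unique[OF geo]
    by simp
qed

lemma four_fifteenths_exp_less_1: "4 / 15 * exp (19 / 15 :: real) < 1"
proof -
  \<comment> \<open>The bound \<open>exp x <= 1 + x + x^2\<close> is available on the unit interval
    and sharp for small \<open>x\<close>, hence the splitting into 19 steps of
    \<open>1/15\<close>.\<close>
  have "exp (19 / 15 :: real) = exp (1 / 15) ^ 19"
    by (simp flip: exp_of_nat_mult)
  also have "\<dots> \<le> (1 + 1 / 15 + (1 / 15)\<^sup>2) ^ 19"
    by (intro power_mono exp_bound) auto
  also have "\<dots> < 15 / 4"
    by (simp add: power2_eq_square power_divide)
  finally show ?thesis
    by simp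
qed

text \<open>Any constant \<open>c > 1 / 4\<close> with \<open>c * exp (1 + c) \<le> 1\<close> would serve instead of \<open>4 / 15\<close>; that
  \<open>1 / 4\<close> itself satisfies this with room to spare leaves space for the rounding of degrees.\<close>

lemma truncated_exp_nonzero:
  fixes y :: complex
  assumes "cmod y \<le> 4 / 15 * real L"
  shows "(\<Sum>j\<le>L. y ^ j / fact j) \<noteq> 0"
proof
  assume "(\<Sum>j\<le>L. y ^ j / fact j) = 0"
  \<comment> \<open>If the truncation vanishes, the tail bound controls \<open>exp y\<close> itself.
    The factor \<open>4/11\<close> is \<open>c / (1 - c)\<close> at \<open>c = 4/15\<close>; the
    contradiction will be \<open>1 <= 4/11\<close>.\<close>
  then have "exp (Re y) \<le> 4 / 11 * (4 / 15 * exp 1) ^ L"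
    using exp_tail_le[OF assms] by simp
  moreover have "exp (- (4 / 15 * real L)) \<le> exp (Re y)"
    using abs_Re_le_cmod[of y] assms by simp
  ultimately have "exp (- (4 / 15 * real L)) \<le> 4 / 11 * (4 / 15 * exp 1) ^ L"
    by (meson order_trans)
  then have "exp (4 / 15 * real L) * exp (- (4 / 15 * real L))
      \<le> exp (4 / 15 * real L) * (4 / 11 * (4 / 15 * exp 1) ^ L)"
    by (intro mult_left_mono) auto
  also have "\<dots> = 4 / 11 * (4 / 15 * exp (19 / 15)) ^ L"
  proof -
    have "exp (19 / 15 :: real) = exp (4 / 15) * exp 1"
      by (simp flip: exp_add)
    moreover have "exp (4 / 15 * real L) = exp (4 / 15) ^ L"
      by (simp add: mult.commute flip: exp_of_nat_mult)
    ultimately show ?thesis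
      by (simp only: power_mult_distrib mult_ac)
  qed
  also have "\<dots> \<le> 4 / 11 * 1"
    using four_fifteenths_exp_less_1 by (intro mult_left_mono power_le_one) auto
  finally show False
    by (simp flip: exp_add)
qed

definition truncated_exp :: "nat \<Rightarrow> 'a :: field_char_0 poly" where
  "truncated_exp L = (\<Sum>j\<le>L. monom (1 / fact j) j)"

lemma poly_truncated_exp: "poly (truncated_exp L) y = (\<Sum>j\<le>L. y ^ j / fact j)"
  by (simp add: truncated_exp_def poly_sum poly_monom)

lemma degree_truncated_exp_le: "degree (truncated_exp L) \<le> L"
  unfolding truncated_exp_def
  by (intro degree_sum_le) (auto intro: order_trans[OF degree_monom_le])

lemma pderiv_truncated_exp:
  "pderiv (truncated_exp L) = truncated_exp L - monom (1 / fact L :: 'a :: field_char_0) L"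
proof (induction L)
  case 0
  show ?case
    by (simp add: truncated_exp_def pderiv_monom)
next
  case (Suc L)
  have "truncated_exp (Suc L) = truncated_exp L + monom (1 / fact (Suc L) :: 'a) (Suc L)"
    by (simp add: truncated_exp_def)
  moreover have "of_nat (Suc L) * (1 / fact (Suc L)) = 1 / (fact L :: 'a)"
    by (simp del: of_nat_Suc)
  ultimately show ?case
    using Suc by (simp add: pderiv_add pderiv_monom del: of_nat_Suc fact_Suc)
qed

text \<open>For the full series \<open>exp (c z^k)\<close> the equation is exact; truncation leaves
  a monomial of degree \<open>k (L + 1) - 1\<close>, which is at least \<open>n\<close>.\<close>

lemma log_deriv_cong_truncated_exp:
  assumes "n < k * Suc L"
  shows "log_deriv_cong n (pcompose (truncated_exp L) (monom c k)) (monom (of_nat k * c) (k - 1))"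
proof -
  have "pderiv (pcompose (truncated_exp L) (monom c k))
      - pcompose (truncated_exp L) (monom c k) * monom (of_nat k * c) (k - 1)
      = - (pcompose (monom (1 / fact L) L) (monom c k) * monom (of_nat k * c) (k - 1))"
    by (simp add: pderiv_pcompose pderiv_truncated_exp pcompose_diff pderiv_monom algebra_simps)
  also have "pcompose (monom (1 / fact L) L) (monom c k) = smult (1 / fact L) (monom (c ^ L) (k * L))"
    by (simp add: monom_altdef pcompose_smult pcompose_hom.hom_power pcompose_pCons power_mult_distrib
        power_mult smult_power)
  finally show ?thesis
    using assms by (auto simp: log_deriv_cong_def monom_1_dvd_iff' smult_monom mult_monom)
qed

section \<open>Self-inversive polynomials\<close>

text \<open>A Blaschke factor estimate: the left side is \<open>cmod (1 - cnj z * a)\<close>, and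
  the two squares differ by \<open>(1 - |z|^2) (|a|^2 - 1)\<close>.\<close>

lemma cmod_reflected_linear_le:
  assumes "cmod z \<le> 1" and "1 \<le> cmod a" and "z \<noteq> 0"
  shows "cmod z * cmod (1 / cnj z - a) \<le> cmod (z - a)"
proof -
  have "cmod z * cmod (1 / cnj z - a) = cmod (cnj z * (1 / cnj z - a))"
    by (simp add: norm_mult)
  also have "cnj z * (1 / cnj z - a) = 1 - cnj z * a"
    using assms by (simp add: field_simps)
  finally have eq: "cmod z * cmod (1 / cnj z - a) = cmod (1 - cnj z * a)" .
  have "(cmod (z - a))\<^sup>2 - (cmod (1 - cnj z * a))\<^sup>2 = (1 - (cmod z)\<^sup>2) * ((cmod a)\<^sup>2 - 1)"
    unfolding cmod_power2 by (simp add: power2_eq_square algebra_simps)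
  moreover have "\<dots> \<ge> 0"
    using assms by (intro mult_nonneg_nonneg) (auto simp: power_le_one)
  ultimately have "(cmod (1 - cnj z * a))\<^sup>2 \<le> (cmod (z - a))\<^sup>2"
    by linarith
  then show ?thesis
    unfolding eq by (rule power2_le_imp_le) (rule norm_ge_zero)
qed

lemma cmod_reflected_poly_le:
  assumes root: "\<And>x. poly p x = 0 \<Longrightarrow> 1 \<le> cmod x" and z: "cmod z \<le> 1" "z \<noteq> 0"
  shows "cmod z ^ degree p * cmod (poly p (1 / cnj z)) \<le> cmod (poly p z)"
proof -
  obtain as where p: "smult (lead_coeff p) (\<Prod>a\<leftarrow>as. [:- a, 1:]) = p" and len: "length as = degree p"
    using fundamental_theorem_algebra_factorized by blast
  have ev: "poly p x = lead_coeff p * (\<Prod>a\<leftarrow>as. x - a)" for x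
    by (subst p[symmetric]) (simp add: poly_prod_list o_def)
  have "\<forall>a\<in>set as. 1 \<le> cmod a"
    using root by (auto simp: ev prod_list_zero_iff)
  then have "cmod z ^ length as * cmod (\<Prod>a\<leftarrow>as. 1 / cnj z - a) \<le> cmod (\<Prod>a\<leftarrow>as. z - a)"
  proof (induction as)
    case (Cons a as)
    have "(cmod z * cmod (1 / cnj z - a)) * (cmod z ^ length as * cmod (\<Prod>a\<leftarrow>as. 1 / cnj z - a))
        \<le> cmod (z - a) * cmod (\<Prod>a\<leftarrow>as. z - a)"
      using Cons z by (intro mult_mono cmod_reflected_linear_le) auto
    then show ?case
      by (simp add: norm_mult mult_ac)
  qed simp
  then have "cmod (lead_coeff p) * (cmod z ^ length as * cmod (\<Prod>a\<leftarrow>as. 1 / cnj z - a))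
      \<le> cmod (lead_coeff p) * cmod (\<Prod>a\<leftarrow>as. z - a)"
    by (intro mult_left_mono) auto
  then show ?thesis
    by (simp add: ev[of z] ev[of "1 / cnj z"] norm_mult len mult_ac)
qed

text \<open>Inside the disc, the surplus factor \<open>|z|^(n - degree q) < 1\<close> makes the
  reflected term strictly smaller than \<open>q(z)\<close>, so the two cannot cancel. Outside, the
  same comparison is made at the mirror point \<open>1 / cnj z\<close>.\<close>

lemma self_inversive_root:
  assumes root: "\<And>x. poly q x = 0 \<Longrightarrow> 1 < cmod x" and deg: "degree q < n"
    and z: "z \<noteq> 0" "poly q z + z ^ n * cnj (poly q (1 / cnj z)) = 0"
  shows "cmod z = 1"
proof -
  have root': "poly q x = 0 \<Longrightarrow> 1 \<le> cmod x" for x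
    using root[of x] by simp
  have "poly q z = - (z ^ n * cnj (poly q (1 / cnj z)))"
    using z(2) by (simp add: eq_neg_iff_add_eq_0)
  then have eq: "cmod (poly q z) = cmod z ^ n * cmod (poly q (1 / cnj z))"
    by (simp add: norm_mult norm_power)
  show ?thesis
  proof (cases "cmod z" "1 :: real" rule: linorder_cases)
    case less
    then have nz: "poly q z \<noteq> 0"
      using root[of z] by auto
    have "cmod (poly q z) = cmod z ^ (n - degree q) * (cmod z ^ degree q * cmod (poly q (1 / cnj z)))"
      using deg by (simp add: eq flip: mult.assoc power_add)
    also have "\<dots> \<le> cmod z ^ (n - degree q) * cmod (poly q z)"
      using less z by (intro mult_left_mono cmod_reflected_poly_le root') auto
    also have "\<dots> < 1 * cmod (poly q z)"
      using less deg nz by (intro mult_strict_right_mono) (auto simp: power_less_one_iff)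
    finally show ?thesis
      by simp
  next
    case greater
    define y where "y = 1 / cnj z"
    have y: "cmod y = 1 / cmod z" "cmod y < 1" "y \<noteq> 0" "1 / cnj y = z"
      using greater z(1) by (auto simp: y_def norm_divide)
    then have nz: "poly q y \<noteq> 0"
      using root[of y] by auto
    have "cmod y ^ degree q * cmod (poly q z) \<le> cmod (poly q y)"
      using cmod_reflected_poly_le[where p = q and z = y, OF root'] y by simp
    moreover have "cmod y ^ degree q * cmod (poly q z) = cmod z ^ (n - degree q) * cmod (poly q y)"
    proof -
      have "cmod z ^ n = cmod z ^ degree q * cmod z ^ (n - degree q)"
        using deg by (simp flip: power_add)
      then show ?thesis
        using greater z(1) by (simp add: eq y(1) field_simps flip: y_def)
    qed
    moreover have "1 * cmod (poly q y) < cmod z ^ (n - degree q) * cmod (poly q y)"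
      using greater deg nz by (intro mult_strict_right_mono) auto
    ultimately show ?thesis
      by simp
  qed simp
qed

lemma log_deriv_cong_unit_roots:
  fixes q :: "complex poly"
  assumes root: "\<And>x. poly q x = 0 \<Longrightarrow> 1 < cmod x" and q0: "coeff q 0 = 1"
    and deg: "degree q + n < N" and cong: "log_deriv_cong n q s"
  obtains as where "length as = N" and "\<And>a. a \<in> set as \<Longrightarrow> cmod a = 1"
    and "log_deriv_cong n (\<Prod>a\<leftarrow>as. [:- a, 1:]) s"
proof -
  \<comment> \<open>This is \<open>z^N cnj (q (1 / cnj z))\<close> as a polynomial;
    \<open>q(0) = 1\<close> makes it monic of degree \<open>N\<close>.\<close>
  define r where "r = monom 1 (N - degree q) * reflect_poly (map_poly cnj q)"
  define p where "p = q + r"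
  have dq: "degree (map_poly cnj q) = degree q"
    by (rule degree_map_poly) auto
  have q0': "coeff (map_poly cnj q) 0 = 1"
    by (simp add: coeff_map_poly q0)
  then have "map_poly cnj q \<noteq> 0"
    by (metis coeff_0 zero_neq_one)
  then have dr: "degree r = N"
    using q0' deg by (simp add: r_def degree_mult_eq degree_monom_eq monom_eq_0_iff dq)
  have lr: "lead_coeff r = 1"
    using q0' deg by (simp add: dr) (simp add: r_def coeff_monom_mult coeff_reflect_poly dq)
  have dp: "degree p = N" and lp: "lead_coeff p = 1"
    using deg lr by (auto simp: p_def dr degree_add_eq_right coeff_eq_0)
  have p0: "coeff p 0 = 1"
    using deg by (simp add: p_def r_def coeff_monom_mult q0)
  have coeff_r: "coeff r k = 0" if "k \<le> n" for k
    using that deg by (simp add: r_def coeff_monom_mult)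
  \<comment> \<open>Index \<open>n\<close> itself must be covered because \<open>pderiv\<close>
    lowers the order by one; this is why \<open>degree q + n < N\<close> is strict.\<close>
  have "monom 1 n dvd r" and "monom 1 n dvd pderiv r"
    by (simp_all add: monom_1_dvd_iff' coeff_pderiv coeff_r)
  then have "log_deriv_cong n r s"
    by (simp add: log_deriv_cong_def)
  then have "log_deriv_cong n p s"
    unfolding p_def by (rule log_deriv_cong_add[OF cong])
  obtain as where as: "smult (lead_coeff p) (\<Prod>a\<leftarrow>as. [:- a, 1:]) = p" "length as = degree p"
    using fundamental_theorem_algebra_factorized by blast
  have pas: "p = (\<Prod>a\<leftarrow>as. [:- a, 1:])"
    using as(1) lp by simp
  show thesis
  proof
    show "length as = N"
      using as dp by simp
    show "log_deriv_cong n (\<Prod>a\<leftarrow>as. [:- a, 1:]) s"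
      using \<open>log_deriv_cong n p s\<close> by (simp add: pas)
    show "cmod a = 1" if "a \<in> set as" for a
    proof (rule self_inversive_root[OF root])
      have pa: "poly p a = 0"
        using that by (auto simp: pas poly_prod_list o_def prod_list_zero_iff)
      show "a \<noteq> 0"
        using pa p0 by (auto simp: poly_0_coeff_0)
      then have "poly r a = a ^ (N - degree q) * (a ^ degree q * cnj (poly q (1 / cnj a)))"
        by (simp add: r_def poly_monom poly_reflect_poly_nz dq inverse_eq_divide)
      also have "\<dots> = a ^ N * cnj (poly q (1 / cnj a))"
        using deg by (simp flip: mult.assoc power_add)
      finally show "poly q a + a ^ N * cnj (poly q (1 / cnj a)) = 0"
        using pa by (simp add: p_def)
    qed (use deg in auto)
  qed
qed

section \<open>Prescribed power sums\<close>

lemma block_exists: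
  fixes b :: complex and k n :: nat
  assumes "1 \<le> k" and "k \<le> n"
  obtains q where "\<And>x. poly q x = 0 \<Longrightarrow> 1 < cmod x" and "coeff q 0 = 1"
    and "real (degree q) \<le> 15 / 4 * cmod b + real n"
    and "log_deriv_cong n q (monom (- b) (k - 1))"
proof (cases "b = 0")
  case True
  then show ?thesis
    using that[of 1] log_deriv_cong_1[of n] by simp
next
  case False
  define L where "L = n div k"
  \<comment> \<open>Least \<open>m\<close> for which \<open>c\<close> meets the bound
    \<open>4/15 * L\<close>; rounding up costs at most one more factor, of degree at most
    \<open>k * L <= n\<close>. The choice of \<open>c\<close> makes \<open>m\<close> copies of
    \<open>exp (c z^k)\<close> multiply to \<open>exp (- b z^k / k)\<close>.\<close>
  define m where "m = nat \<lceil>15 / 4 * cmod b / real (k * L)\<rceil>"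
  define c where "c = - b / of_nat (k * m)"
  define h where "h = pcompose (truncated_exp L) (monom c k)"
  have "1 \<le> L" "k * L \<le> n" "n < k * Suc L"
    using assms by (auto simp: L_def div_greater_zero_iff Suc_le_eq dividend_less_times_div)
  then have kL: "0 < real (k * L)"
    using assms by simp
  have quot: "0 < 15 / 4 * cmod b / real (k * L)"
    using False kL by (intro divide_pos_pos) auto
  then have m: "15 / 4 * cmod b / real (k * L) \<le> real m" "real m \<le> 15 / 4 * cmod b / real (k * L) + 1"
    unfolding m_def by linarith+
  then have "0 < m"
    using quot by (auto intro!: Nat.gr0I)
  have c: "cmod c \<le> 4 / 15 * real L"
    using m(1) kL \<open>0 < m\<close> assms by (simp add: c_def norm_divide norm_mult field_simps)
  show ?thesis
  proof (rule that[of "h ^ m"])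
    show "1 < cmod x" if "poly (h ^ m) x = 0" for x
    proof (rule ccontr)
      assume "\<not> 1 < cmod x"
      then have "cmod (c * x ^ k) \<le> cmod c * 1"
        unfolding norm_mult norm_power by (intro mult_left_mono power_le_one) auto
      then have "cmod (c * x ^ k) \<le> 4 / 15 * real L"
        using c by simp
      from truncated_exp_nonzero[OF this] that show False
        by (simp add: h_def poly_pcompose poly_monom poly_truncated_exp)
    qed
    have "poly h 0 = 1"
      using assms
      by (simp add: h_def poly_pcompose poly_monom poly_truncated_exp power_0_left sum.delta
          if_distrib[of "\<lambda>x. x / _"] cong: if_cong)
    then show "coeff (h ^ m) 0 = 1"
      by (simp add: flip: poly_0_coeff_0)
    have "degree h \<le> k * L"
      unfolding h_def
      using mult_le_mono[OF degree_truncated_exp_le[of L] degree_monom_le[of c k]]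
      by (intro order_trans[OF degree_pcompose_le]) (simp add: mult.commute)
    then have "degree (h ^ m) \<le> k * L * m"
      using degree_power_le[of h m] by (meson le_trans mult_le_mono1)
    then have "real (degree (h ^ m)) \<le> real (k * L) * real m"
      by (metis of_nat_le_iff of_nat_mult)
    also have "\<dots> \<le> real (k * L) * (15 / 4 * cmod b / real (k * L) + 1)"
      using kL m(2) by (intro mult_left_mono) auto
    also have "\<dots> = 15 / 4 * cmod b + real (k * L)"
      using kL by (simp add: distrib_left del: of_nat_mult)
    also have "\<dots> \<le> 15 / 4 * cmod b + real n"
      using \<open>k * L \<le> n\<close> by (simp only: add_left_mono of_nat_le_iff)
    finally show "real (degree (h ^ m)) \<le> 15 / 4 * cmod b + real n" .
    have "of_nat m * monom (of_nat k * c) (k - 1) = monom (- b) (k - 1)"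
      using \<open>0 < m\<close> assms by (simp add: c_def of_nat_poly smult_monom)
    then show "log_deriv_cong n (h ^ m) (monom (- b) (k - 1))"
      using log_deriv_cong_power[OF log_deriv_cong_truncated_exp[OF \<open>n < k * Suc L\<close>, of c], of m]
      by (simp add: h_def)
  qed
qed

text \<open>The blocks have total degree at most \<open>15/4\<close> times the sum of the
  \<open>|b k|\<close> plus \<open>n * n\<close>; the further \<open>n\<close> is the gap between
  \<open>degree Q\<close> and \<open>N\<close> that the reflection requires.\<close>

lemma unit_power_sums_exist:
  fixes b :: "nat \<Rightarrow> complex"
  assumes "15 / 4 * (\<Sum>k = 1..n. cmod (b k)) + real n * real n + real n < real N"
  obtains ws where "length ws = N" and "\<And>w. w \<in> set ws \<Longrightarrow> cmod w = 1"
    and "\<And>k. k \<in> {1..n} \<Longrightarrow> (\<Sum>w\<leftarrow>ws. w ^ k) = b k"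
proof -
  have "\<forall>k\<in>{1..n}. \<exists>q. (\<forall>x. poly q x = 0 \<longrightarrow> 1 < cmod x) \<and> coeff q 0 = 1
      \<and> real (degree q) \<le> 15 / 4 * cmod (b k) + real n
      \<and> log_deriv_cong n q (monom (- b k) (k - 1))"
  proof
    fix k assume k: "k \<in> {1..n}"
    show "\<exists>q. (\<forall>x. poly q x = 0 \<longrightarrow> 1 < cmod x) \<and> coeff q 0 = 1
      \<and> real (degree q) \<le> 15 / 4 * cmod (b k) + real n
      \<and> log_deriv_cong n q (monom (- b k) (k - 1))"
      by (rule block_exists[of k n "b k"]) (use k in auto)
  qed
  then obtain q where q: "\<And>k x. k \<in> {1..n} \<Longrightarrow> poly (q k) x = 0 \<Longrightarrow> 1 < cmod x"
    "\<And>k. k \<in> {1..n} \<Longrightarrow> coeff (q k) 0 = 1"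
    "\<And>k. k \<in> {1..n} \<Longrightarrow> real (degree (q k)) \<le> 15 / 4 * cmod (b k) + real n"
    "\<And>k. k \<in> {1..n} \<Longrightarrow> log_deriv_cong n (q k) (monom (- b k) (k - 1))"
    by metis
  define Q where "Q = (\<Prod>k = 1..n. q k)"
  define s where "s = (\<Sum>k = 1..n. monom (- b k) (k - 1))"
  have root: "1 < cmod x" if "poly Q x = 0" for x
    using that q(1) by (auto simp: Q_def poly_prod)
  have Q0: "coeff Q 0 = 1"
    using q(2) by (simp add: Q_def poly_prod flip: poly_0_coeff_0)
  have "real (degree Q) \<le> (\<Sum>k = 1..n. real (degree (q k)))"
    using degree_prod_sum_le[of "{1..n}" q] unfolding Q_def o_def
    by (metis finite_atLeastAtMost of_nat_le_iff of_nat_sum)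
  also have "\<dots> \<le> (\<Sum>k = 1..n. 15 / 4 * cmod (b k) + real n)"
    by (intro sum_mono q)
  also have "\<dots> = 15 / 4 * (\<Sum>k = 1..n. cmod (b k)) + real n * real n"
    by (simp add: sum.distrib sum_distrib_left)
  finally have deg: "degree Q + n < N"
    using assms by linarith
  have "log_deriv_cong n Q s"
    unfolding Q_def s_def by (intro log_deriv_cong_prod q)
  from log_deriv_cong_unit_roots[OF root Q0 deg this]
  obtain as where as: "length as = N" "\<And>a. a \<in> set as \<Longrightarrow> cmod a = 1"
    "log_deriv_cong n (\<Prod>a\<leftarrow>as. [:- a, 1:]) s"
    by blast
  have "0 \<notin> set as"
    using as(2) by force
  have nz: "coeff (\<Prod>a\<leftarrow>as. [:- a, 1:]) 0 \<noteq> 0"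
    using \<open>0 \<notin> set as\<close> by (auto simp: poly_prod_list o_def prod_list_zero_iff simp flip: poly_0_coeff_0)
  show thesis
  \<comment> \<open>Expansion at 0 yields power sums of the inverse roots, and inversion preserves
    the unit circle.\<close>
  proof (rule that[of "map inverse as"])
    fix k assume k: "k \<in> {1..n}"
    then have "coeff s (k - 1)
        = coeff (- (\<Sum>i<n. monom (\<Sum>a\<leftarrow>as. inverse a ^ Suc i) i)) (k - 1)"
      using log_deriv_cong_unique[OF as(3) log_deriv_cong_linear_factors[OF \<open>0 \<notin> set as\<close>] nz]
      by auto
    also have "\<dots> = - (\<Sum>a\<leftarrow>as. inverse a ^ k)"
      using k by (cases k) (auto simp: coeff_sum)
    also have "coeff s (k - 1) = (\<Sum>i = 1..n. if i = k then - b i else 0)"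
      unfolding s_def coeff_sum using k by (intro sum.cong) auto
    also have "\<dots> = - b k"
      using k by simp
    finally show "(\<Sum>w\<leftarrow>map inverse as. w ^ k) = b k"
      by (simp add: o_def)
  qed (use as in \<open>auto simp: norm_inverse\<close>)
qed

theorem lemmaV1:
  fixes T N :: nat and \<alpha> :: "nat \<Rightarrow> complex"
  assumes "T \<ge> 1" and "N \<ge> 1"
    and "real N \<ge> 16 * (2 * real T + 1) * real T powr (5 / 2)"
    and "(\<Sum>k = 1..T. cmod (\<alpha> k)) \<le> 1 / 4"
  shows "\<exists>U \<in> unitary_group N. \<forall>k \<in> {1..T}.
           \<alpha> k = 1 / of_nat N * mat_trace (U ^\<^sub>m k)"
proof -
  define t where "t = real T"
  have t: "1 \<le> t"
    using assms(1) by (simp add: t_def)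
  have "t\<^sup>2 \<le> t powr (5 / 2)"
    using t powr_mono[of 2 "5 / 2" t] by simp
  then have "(2 * t + 1) * t\<^sup>2 \<le> (2 * t + 1) * t powr (5 / 2)"
    using t by (intro mult_left_mono) auto
  moreover have "16 * ((2 * t + 1) * t powr (5 / 2)) \<le> real N"
    using assms(3) by (simp only: t_def mult.assoc)
  ultimately have N: "(2 * t + 1) * t\<^sup>2 \<le> real N / 16"
    by linarith
  have "t * 1 \<le> t * t\<^sup>2"
    using t by (intro mult_left_mono) auto
  \<comment> \<open>With \<open>b k = N \<alpha> k\<close> the blocks use at most
    \<open>15/4 * N/4 = 15/16 * N\<close>, so \<open>N/16\<close> remains for
    \<open>t * t + t\<close>.\<close>
  then have small: "t * t + t < real N / 16"
  proof -
    have "(2 * t + 1) * t\<^sup>2 = 2 * (t * t\<^sup>2) + t * t"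
      by (simp add: power2_eq_square algebra_simps)
    then show ?thesis
      using N t \<open>t * 1 \<le> t * t\<^sup>2\<close> by linarith
  qed
  have "(\<Sum>k = 1..T. cmod (of_nat N * \<alpha> k)) = real N * (\<Sum>k = 1..T. cmod (\<alpha> k))"
    by (simp add: norm_mult sum_distrib_left)
  also have "\<dots> \<le> real N * (1 / 4)"
    using assms(4) by (intro mult_left_mono) auto
  finally have "15 / 4 * (\<Sum>k = 1..T. cmod (of_nat N * \<alpha> k)) + real T * real T + real T < real N"
    using small by (simp add: t_def)
  from unit_power_sums_exist[OF this] obtain ws where ws: "length ws = N"
    "\<And>w. w \<in> set ws \<Longrightarrow> cmod w = 1"
    "\<And>k. k \<in> {1..T} \<Longrightarrow> (\<Sum>w\<leftarrow>ws. w ^ k) = of_nat N * \<alpha> k"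
    by blast
  show ?thesis
  proof (intro bexI ballI)
    show "mat_diag N ((!) ws) \<in> unitary_group N"
      using ws by (intro mat_diag_unitary) auto
    fix k assume "k \<in> {1..T}"
    then show "\<alpha> k = 1 / of_nat N * mat_trace (mat_diag N ((!) ws) ^\<^sub>m k)"
      using ws(1) ws(3)[of k] assms(2)
      by (simp add: mat_diag_pow mat_trace_diag sum_list_sum_nth atLeast0LessThan)
  qed
qed

end
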